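(* Let $\beta>1$, let $0\le t\le 1-\frac1\beta$, and write $\overline{d}_\beta(t)=as$ with $a\in A_\beta$ and $s\in A_\beta^{\mathbb{N}}$; put $b=a+1$ and $I=[t,t+\frac1\beta]$. (a) If $s\le a^\omega$, then $I$ contains the $\overline{T}_\beta$-orbit closure of $(a^\omega)_\beta$, which is invariant, is the unique invariant $\overline{T}_\beta$-orbit closure contained in $I$, and has frequency $a$. (b) If $s\ge b^\omega$, then $I$ contains the $\overline{T}_\beta$-orbit closure of $(b^\omega)_\beta$, which is invariant, is the unique invariant $\overline{T}_\beta$-orbit closure contained in $I$, and has frequency $b$. (c) If $as=s_{\alpha,0}$ or $bs=s'_{\alpha,0}$ for some $\alpha\in[a,b]$, then $I$ contains the $\overline{T}_\beta$-orbit closure of $(s'_{\alpha,0})_\beta$, which is invariant, is the unique invariant $\overline{T}_\beta$-orbit closure contained in $I$, and has frequency $\alpha$.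
   Context: For $\beta>1$ let $A_\beta=\{0,1,\dots,\lceil\beta\rceil-1\}$. Infinite words over nonnegative integers are compared lexicographically. For a word $w=w_1w_2\cdots$ of nonnegative integers, $(w)_\beta=\sum_{i\ge1}w_i\beta^{-i}$; $v^\omega=vvv\cdots$. Define $\langle t\rangle=\{t\}$ (fractional part) if $t\notin\mathbb{Z}$ and $\langle t\rangle=1$ if $t\in\mathbb{Z}$. The $\overline{\beta}$-transformation $\overline{T}_\beta:[0,1]\to(0,1]$ is $\overline{T}_\beta(x)=\langle\beta x\rangle$ and the $\overline{\beta}$-expansion of $x\in[0,1]$ is $\overline{d}_\beta(x)=(x_i)_{i\ge1}$ with $x_i=\lceil\beta\overline{T}_\beta^{i-1}(x)\rceil-1$. A $\overline{T}_\beta$-orbit closure is the closure of $\{\overline{T}_\beta^n(x):n\ge0\}$; it is invariant if $\overline{T}_\beta(S)=S$. The frequency of $x$ is $\lim_{n\to\infty}\frac1n\sum_{k=1}^na_k$ where $\overline{d}_\beta(x)=a_1a_2\cdots$; a set has frequency $\alpha$ if all its elements have frequency $\alpha$. For real $\alpha\ge0$, $s_{\alpha,0}$ and $s'_{\alpha,0}$ are the infinite words with $n$-th letters ($n\ge0$) $\lfloor\alpha(n+1)\rfloor-\lfloor\alpha n\rfloor$ and $\lceil\alpha(n+1)\rceil-\lceil\alpha n\rceil$ respectively (lower and upper mechanical words of slope $\alpha$ and intercept $0$). *)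

theory Defs
  imports Complex_Main "HOL-Analysis.Analysis" "HOL-Library.Fun_Lexorder"
begin

text \<open>
  Infinite words are functions \<open>nat \<Rightarrow> int\<close>, indexed from 0; the word \<open>a s\<close> is \<open>case_nat a s\<close>
  and \<open>a\<^sup>\<omega>\<close> is the constant function. Letters are integers rather than naturals because the
  digit formula \<open>\<lceil>\<beta> * x\<rceil> - 1\<close> yields \<open>-1\<close> at \<open>x = 0\<close>, which truncated subtraction would
  silently turn into the admissible digit \<open>0\<close>.
\<close>

definition alphabet :: "real \<Rightarrow> int set" where
  "alphabet \<beta> = {0..\<lceil>\<beta>\<rceil> - 1}"

definition lex_le :: "(nat \<Rightarrow> int) \<Rightarrow> (nat \<Rightarrow> int) \<Rightarrow> bool" where
  "lex_le u v \<longleftrightarrow> u = v \<or> less_fun u v"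

definition word_value :: "real \<Rightarrow> (nat \<Rightarrow> int) \<Rightarrow> real" where
  "word_value \<beta> w = (\<Sum>i. of_int (w i) / \<beta> ^ Suc i)"

definition upper_frac :: "real \<Rightarrow> real" where
  "upper_frac x = (if x \<in> \<int> then 1 else frac x)"

definition Tbar :: "real \<Rightarrow> real \<Rightarrow> real" where
  "Tbar \<beta> x = upper_frac (\<beta> * x)"

definition dbar :: "real \<Rightarrow> real \<Rightarrow> nat \<Rightarrow> int" where
  "dbar \<beta> x i = \<lceil>\<beta> * (Tbar \<beta> ^^ i) x\<rceil> - 1"

definition orbit_closure :: "real \<Rightarrow> real \<Rightarrow> real set" where
  "orbit_closure \<beta> x = closure (range (\<lambda>n. (Tbar \<beta> ^^ n) x))"

definition is_orbit_closure :: "real \<Rightarrow> real set \<Rightarrow> bool" where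
  "is_orbit_closure \<beta> S \<longleftrightarrow> (\<exists>x\<in>{0..1}. S = orbit_closure \<beta> x)"

definition Tbar_invariant :: "real \<Rightarrow> real set \<Rightarrow> bool" where
  "Tbar_invariant \<beta> S \<longleftrightarrow> Tbar \<beta> ` S = S"

definition has_frequency :: "real \<Rightarrow> real \<Rightarrow> real \<Rightarrow> bool" where
  "has_frequency \<beta> x \<alpha> \<longleftrightarrow>
     (\<lambda>n. 1 / real n * (\<Sum>k<n. real_of_int (dbar \<beta> x k))) \<longlonglongrightarrow> \<alpha>"

definition set_has_frequency :: "real \<Rightarrow> real set \<Rightarrow> real \<Rightarrow> bool" where
  "set_has_frequency \<beta> S \<alpha> \<longleftrightarrow> (\<forall>x\<in>S. has_frequency \<beta> x \<alpha>)"

definition lower_mechanical :: "real \<Rightarrow> nat \<Rightarrow> int" where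
  "lower_mechanical \<alpha> n = \<lfloor>\<alpha> * (real n + 1)\<rfloor> - \<lfloor>\<alpha> * real n\<rfloor>"

definition upper_mechanical :: "real \<Rightarrow> nat \<Rightarrow> int" where
  "upper_mechanical \<alpha> n = \<lceil>\<alpha> * (real n + 1)\<rceil> - \<lceil>\<alpha> * real n\<rceil>"

definition unique_invariant_orbit_closure_in :: "real \<Rightarrow> real set \<Rightarrow> real set \<Rightarrow> bool" where
  "unique_invariant_orbit_closure_in \<beta> J S \<longleftrightarrow>
     (\<forall>S'. is_orbit_closure \<beta> S' \<and> Tbar_invariant \<beta> S' \<and> S' \<subseteq> J \<longleftrightarrow> S' = S)"

end

theory Submission
  imports Defs
begin

text \<open>
  Call a point staying if its whole orbit lies in \<open>J\<close>. On staying points the map behaves like a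
  monotone circle map of degree one: the digit sums of any two of them, over the same length,
  differ by at most one. If \<open>J\<close> contains a staying point \<open>y\<close> whose expansion is the upper mechanical
  word of slope \<open>\<alpha>\<close>, then the averages of length-\<open>n\<close> digit sums along every staying orbit converge
  to \<open>\<alpha> n\<close>. An orbit closure in \<open>J\<close> is invariant iff its generator is recurrent, and recurrence
  forces the digit sums over length \<open>n\<close> to be \<open>\<alpha> n\<close> whenever this is an integer; with the averages
  this identifies the maximum of the closure as \<open>y\<close>. Conversely the closure of the orbit of \<open>y\<close>
  contains every recurrent staying point: for rational \<open>\<alpha>\<close> such a point is periodic, for irrational
  \<open>\<alpha>\<close> all its prefixes occur along the orbit of \<open>y\<close> by Kronecker's theorem. Cases (a) and (b) are
  the integer slopes, where \<open>y\<close> is a fixed point.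
\<close>

section \<open>Expansions and digit sums\<close>

lemma upper_frac_eq: "upper_frac z = z - of_int (\<lceil>z\<rceil> - 1)"
  by (auto simp: upper_frac_def frac_def ceiling_altdef elim!: Ints_cases) (metis Ints_of_int)

lemma Tbar_eq: "Tbar \<beta> x = \<beta> * x - of_int (dbar \<beta> x 0)"
  by (simp add: Tbar_def dbar_def upper_frac_eq)

lemma Tbar_bounds: "Tbar \<beta> x \<in> {0<..1}"
  using ceiling_correct[of "\<beta> * x"] by (simp add: Tbar_def upper_frac_eq)

lemma funpow_Tbar_bounds:
  assumes "x \<in> {0<..1}"
  shows "(Tbar \<beta> ^^ n) x \<in> {0<..1}"
  using assms Tbar_bounds by (cases n) auto

lemma Tbar_dbar_unique:
  assumes "\<beta> * x - of_int d \<in> {0<..1}"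
  shows "dbar \<beta> x 0 = d" "Tbar \<beta> x = \<beta> * x - of_int d"
proof -
  have "\<lceil>\<beta> * x\<rceil> = d + 1"
    using assms by (intro ceiling_unique) auto
  then show "dbar \<beta> x 0 = d" "Tbar \<beta> x = \<beta> * x - of_int d"
    by (simp_all add: Tbar_eq dbar_def)
qed

lemma dbar_0_bounds: "of_int (dbar \<beta> x 0) < \<beta> * x" "\<beta> * x \<le> of_int (dbar \<beta> x 0) + 1"
  using Tbar_bounds[of \<beta> x] by (simp_all add: Tbar_eq)

lemma dbar_funpow: "dbar \<beta> ((Tbar \<beta> ^^ m) x) n = dbar \<beta> x (m + n)"
  by (simp add: dbar_def add.commute flip: comp_apply[of "Tbar \<beta> ^^ n"] funpow_add)

lemma dbar_Suc: "dbar \<beta> x (Suc n) = dbar \<beta> (Tbar \<beta> x) n"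
  using dbar_funpow[of \<beta> 1 x n] by simp

lemma funpow_Tbar_Suc: "(Tbar \<beta> ^^ Suc n) x = \<beta> * (Tbar \<beta> ^^ n) x - of_int (dbar \<beta> x n)"
  using dbar_funpow[of \<beta> n x 0] by (simp add: Tbar_eq)

lemma Tbar_le_of_dbar_less:
  assumes "dbar \<beta> x 0 < dbar \<beta> y 0"
  shows "Tbar \<beta> y \<le> \<beta> * (y - x)"
proof -
  have "real_of_int (dbar \<beta> x 0) + 1 \<le> real_of_int (dbar \<beta> y 0)"
    using assms by linarith
  then show ?thesis
    using Tbar_bounds[of \<beta> x] by (simp add: Tbar_eq right_diff_distrib)
qed

lemma Tbar_step_order:
  assumes "1 < \<beta>" "x \<le> y" "\<beta> * (y - x) \<le> 1"
  shows "dbar \<beta> y 0 = dbar \<beta> x 0 \<and> Tbar \<beta> x \<le> Tbar \<beta> y \<or>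
    dbar \<beta> y 0 = dbar \<beta> x 0 + 1 \<and> Tbar \<beta> y \<le> Tbar \<beta> x"
proof -
  have scaled: "\<beta> * x \<le> \<beta> * y" "\<beta> * y \<le> \<beta> * x + 1"
    using assms by (simp_all add: right_diff_distrib)
  then have "\<lceil>\<beta> * x\<rceil> \<le> \<lceil>\<beta> * y\<rceil>" "\<lceil>\<beta> * y\<rceil> \<le> \<lceil>\<beta> * x\<rceil> + 1"
    by linarith+
  then have "dbar \<beta> y 0 = dbar \<beta> x 0 \<or> dbar \<beta> y 0 = dbar \<beta> x 0 + 1"
    by (auto simp: dbar_def)
  then show ?thesis
    using scaled by (auto simp: Tbar_eq)
qed

lemma dbar_expansion:
  assumes "1 < \<beta>"
  shows "x = (\<Sum>i<N. of_int (dbar \<beta> x i) / \<beta> ^ Suc i) + (Tbar \<beta> ^^ N) x / \<beta> ^ N"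
proof (induction N)
  case (Suc N)
  have "of_int (dbar \<beta> x N) / \<beta> ^ Suc N + (Tbar \<beta> ^^ Suc N) x / \<beta> ^ Suc N = (Tbar \<beta> ^^ N) x / \<beta> ^ N"
    using assms unfolding funpow_Tbar_Suc by (simp add: field_simps)
  then show ?case
    using Suc by simp
qed simp

lemma word_value_dbar:
  assumes "1 < \<beta>" "x \<in> {0<..1}"
  shows "word_value \<beta> (dbar \<beta> x) = x"
proof -
  let ?r = "\<lambda>N. (Tbar \<beta> ^^ N) x / \<beta> ^ N"
  have "?r \<longlonglongrightarrow> 0"
  proof (rule Lim_null_comparison)
    show "(\<lambda>N. (1 / \<beta>) ^ N) \<longlonglongrightarrow> 0"
      using assms(1) by (intro LIMSEQ_realpow_zero) auto
    show "\<forall>\<^sub>F N in sequentially. norm (?r N) \<le> (1 / \<beta>) ^ N"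
      using funpow_Tbar_bounds[OF assms(2), of _ \<beta>] assms(1)
      by (intro always_eventually) (simp add: power_one_over divide_right_mono abs_of_pos)
  qed
  then have "(\<lambda>N. x - ?r N) \<longlonglongrightarrow> x - 0"
    by (intro tendsto_intros)
  moreover have "x - ?r N = (\<Sum>i<N. of_int (dbar \<beta> x i) / \<beta> ^ Suc i)" for N
    using dbar_expansion[OF assms(1), of x N] by linarith
  ultimately have "(\<lambda>i. of_int (dbar \<beta> x i) / \<beta> ^ Suc i) sums x"
    by (simp add: sums_def)
  then show ?thesis
    by (simp add: word_value_def sums_iff)
qed

definition digit_sum :: "real \<Rightarrow> real \<Rightarrow> nat \<Rightarrow> int" where
  "digit_sum \<beta> x n = (\<Sum>k<n. dbar \<beta> x k)"

lemma digit_sum_0 [simp]: "digit_sum \<beta> x 0 = 0"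
  by (simp add: digit_sum_def)

lemma digit_sum_Suc: "digit_sum \<beta> x (Suc n) = digit_sum \<beta> x n + dbar \<beta> x n"
  by (simp add: digit_sum_def)

lemma digit_sum_add:
  "digit_sum \<beta> x (m + n) = digit_sum \<beta> x m + digit_sum \<beta> ((Tbar \<beta> ^^ m) x) n"
  by (induction n) (simp_all add: digit_sum_Suc dbar_funpow)

lemma sum_digit_sum_orbit:
  "(\<Sum>k<K. digit_sum \<beta> ((Tbar \<beta> ^^ k) x) n) = (\<Sum>k<n. digit_sum \<beta> ((Tbar \<beta> ^^ k) x) K)"
  unfolding digit_sum_def dbar_funpow by (subst sum.swap) (simp add: add.commute)

text \<open>Summation by parts; \<open>x\<close> becomes monotone in its digit sums.\<close>
lemma digit_sum_expansion:
  assumes "1 < \<beta>"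
  shows "x = (of_int (digit_sum \<beta> x N) + (Tbar \<beta> ^^ N) x) / \<beta> ^ N
    + (\<beta> - 1) * (\<Sum>n<N. of_int (digit_sum \<beta> x n) / \<beta> ^ Suc n)"
proof (induction N)
  case (Suc N)
  have "(of_int (digit_sum \<beta> x (Suc N)) + (Tbar \<beta> ^^ Suc N) x) / \<beta> ^ Suc N
      + (\<beta> - 1) * (of_int (digit_sum \<beta> x N) / \<beta> ^ Suc N)
      = (of_int (digit_sum \<beta> x N) + (Tbar \<beta> ^^ N) x) / \<beta> ^ N"
    using assms unfolding funpow_Tbar_Suc digit_sum_Suc by (simp add: field_simps)
  then show ?case
    using Suc by (simp add: distrib_left)
qed simp

lemma le_of_digit_sum_le:
  assumes "1 < \<beta>" "x \<in> {0<..1}" "y \<in> {0<..1}"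
    and sums_le: "\<And>n. digit_sum \<beta> x n \<le> digit_sum \<beta> y n"
  shows "x \<le> y"
proof -
  have "x \<le> y + (1 / \<beta>) ^ N" for N
  proof -
    have "(\<Sum>n<N. of_int (digit_sum \<beta> x n) / \<beta> ^ Suc n)
        \<le> (\<Sum>n<N. of_int (digit_sum \<beta> y n) / \<beta> ^ Suc n)"
      using assms(1) sums_le by (intro sum_mono divide_right_mono) auto
    then have "(\<beta> - 1) * (\<Sum>n<N. of_int (digit_sum \<beta> x n) / \<beta> ^ Suc n)
        \<le> (\<beta> - 1) * (\<Sum>n<N. of_int (digit_sum \<beta> y n) / \<beta> ^ Suc n)"
      using assms(1) by (intro mult_left_mono) auto
    moreover have "of_int (digit_sum \<beta> x N) + (Tbar \<beta> ^^ N) x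
        \<le> of_int (digit_sum \<beta> y N) + (Tbar \<beta> ^^ N) y + 1"
      using sums_le[of N] funpow_Tbar_bounds[OF assms(2), of N \<beta>]
        funpow_Tbar_bounds[OF assms(3), of N \<beta>]
      by (intro add_mono) auto
    then have "(of_int (digit_sum \<beta> x N) + (Tbar \<beta> ^^ N) x) / \<beta> ^ N
        \<le> (of_int (digit_sum \<beta> y N) + (Tbar \<beta> ^^ N) y) / \<beta> ^ N + (1 / \<beta>) ^ N"
      using assms(1) by (simp add: power_one_over divide_right_mono flip: add_divide_distrib)
    ultimately show ?thesis
      using digit_sum_expansion[OF assms(1), of x N] digit_sum_expansion[OF assms(1), of y N]
      by linarith
  qed
  moreover have "(\<lambda>N. y + (1 / \<beta>) ^ N) \<longlonglongrightarrow> y + 0"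
    using assms(1) by (intro tendsto_intros LIMSEQ_realpow_zero) auto
  ultimately show ?thesis
    by (intro LIMSEQ_le_const[of _ y]) auto
qed

lemma eq_of_digit_sum_eq:
  assumes "1 < \<beta>" "x \<in> {0<..1}" "y \<in> {0<..1}" "\<And>n. digit_sum \<beta> x n = digit_sum \<beta> y n"
  shows "x = y"
  using assms by (intro antisym le_of_digit_sum_le) auto

section \<open>Comparison with constant expansions\<close>

lemma dbar_fixed_point:
  assumes "x \<in> {0<..1}" "(\<beta> - 1) * x = of_int d"
  shows "Tbar \<beta> x = x" "dbar \<beta> x = (\<lambda>_. d)"
proof -
  have "\<beta> * x - of_int d = x"
    using assms(2) by (simp add: algebra_simps)
  then have Tbar_x: "Tbar \<beta> x = x" and dbar_x: "dbar \<beta> x 0 = d"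
    using Tbar_dbar_unique[of \<beta> x d] assms(1) by auto
  have "dbar \<beta> x n = d" for n
    by (induction n) (simp_all add: Tbar_x dbar_x dbar_Suc)
  then show "Tbar \<beta> x = x" "dbar \<beta> x = (\<lambda>_. d)"
    using Tbar_x by blast+
qed

lemma fixed_point_of_constant_dbar:
  assumes "1 < \<beta>" "x \<in> {0<..1}" "dbar \<beta> x = (\<lambda>_. d)"
  shows "(\<beta> - 1) * x = of_int d"
proof -
  have "dbar \<beta> (Tbar \<beta> x) n = dbar \<beta> x n" for n
    using dbar_Suc[of \<beta> x n] by (simp add: assms(3))
  then have "Tbar \<beta> x = x"
    using Tbar_bounds assms by (intro eq_of_digit_sum_eq[of \<beta>]) (simp_all add: digit_sum_def)
  then show ?thesis
    using assms(3) by (simp add: Tbar_eq algebra_simps)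
qed

lemma fixed_point_defect_scales:
  assumes "\<And>i. i < k \<Longrightarrow> dbar \<beta> x i = d"
  shows "(\<beta> - 1) * (Tbar \<beta> ^^ k) x - of_int d = \<beta> ^ k * ((\<beta> - 1) * x - of_int d)"
  using assms
proof (induction k)
  case (Suc k)
  have "(\<beta> - 1) * (Tbar \<beta> ^^ Suc k) x - of_int d = \<beta> * ((\<beta> - 1) * (Tbar \<beta> ^^ k) x - of_int d)"
    unfolding funpow_Tbar_Suc using Suc.prems[of k] by (simp add: algebra_simps)
  then show ?case
    using Suc by simp
qed simp

lemma fixed_point_compare_first_deviation:
  assumes "1 < \<beta>" "x \<in> {0<..1}" "\<And>i. i < k \<Longrightarrow> dbar \<beta> x i = d"
  shows "d < dbar \<beta> x k \<Longrightarrow> of_int d < (\<beta> - 1) * x"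
    and "dbar \<beta> x k < d \<Longrightarrow> (\<beta> - 1) * x < of_int d"
proof -
  let ?z = "(Tbar \<beta> ^^ k) x"
  have iterate_bounds: "0 < ?z" "?z \<le> 1"
    using funpow_Tbar_bounds[OF assms(2), of k \<beta>] by auto
  have digit: "of_int (dbar \<beta> x k) < \<beta> * ?z" "\<beta> * ?z \<le> of_int (dbar \<beta> x k) + 1"
    using dbar_0_bounds[of \<beta> ?z] by (simp_all add: dbar_funpow)
  have scale: "(\<beta> - 1) * ?z - of_int d = \<beta> ^ k * ((\<beta> - 1) * x - of_int d)"
    using assms(3) by (rule fixed_point_defect_scales)
  show "of_int d < (\<beta> - 1) * x" if "d < dbar \<beta> x k"
  proof -
    have "0 < (\<beta> - 1) * ?z - of_int d"
      using that iterate_bounds digit by (simp add: left_diff_distrib)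
    then show ?thesis
      unfolding scale using assms(1) by (simp add: zero_less_mult_iff)
  qed
  show "(\<beta> - 1) * x < of_int d" if "dbar \<beta> x k < d"
  proof -
    have "(\<beta> - 1) * ?z - of_int d < 0"
      using that iterate_bounds digit by (simp add: left_diff_distrib)
    then show ?thesis
      unfolding scale using assms(1) by (simp add: mult_less_0_iff)
  qed
qed

lemma fixed_point_le_of_const_lex_le:
  assumes "1 < \<beta>" "x \<in> {0<..1}" "lex_le (\<lambda>_. d) (dbar \<beta> x)"
  shows "of_int d \<le> (\<beta> - 1) * x"
  using assms(3) fixed_point_of_constant_dbar[OF assms(1,2), of d]
    fixed_point_compare_first_deviation(1)[OF assms(1,2), of _ d]
  by (fastforce simp: lex_le_def less_fun_def)

lemma fixed_point_ge_of_lex_le_const: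
  assumes "1 < \<beta>" "x \<in> {0<..1}" "lex_le (dbar \<beta> x) (\<lambda>_. d)"
  shows "(\<beta> - 1) * x \<le> of_int d"
  using assms(3) fixed_point_of_constant_dbar[OF assms(1,2), of d]
    fixed_point_compare_first_deviation(2)[OF assms(1,2), of _ d]
  by (fastforce simp: lex_le_def less_fun_def)

lemma lex_le_case_nat:
  assumes "lex_le u v"
  shows "lex_le (case_nat d u) (case_nat d v)"
proof (cases "u = v")
  case False
  then obtain k where "u k < v k" "\<forall>i<k. u i = v i"
    using assms by (auto simp: lex_le_def less_fun_def)
  then show ?thesis
    by (auto simp: lex_le_def less_fun_def split: nat.split intro!: exI[of _ "Suc k"])
qed (simp add: lex_le_def)

lemma case_nat_const: "case_nat d (\<lambda>_. d) = (\<lambda>_. d)"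
  by (auto split: nat.split)

section \<open>Common prefixes\<close>

definition same_prefix :: "real \<Rightarrow> nat \<Rightarrow> real \<Rightarrow> real \<Rightarrow> bool" where
  "same_prefix \<beta> N x y \<longleftrightarrow> (\<forall>i<N. dbar \<beta> x i = dbar \<beta> y i)"

lemma same_prefix_iff_digit_sum:
  "same_prefix \<beta> N x y \<longleftrightarrow> (\<forall>n\<le>N. digit_sum \<beta> x n = digit_sum \<beta> y n)"
proof
  assume "same_prefix \<beta> N x y"
  then show "\<forall>n\<le>N. digit_sum \<beta> x n = digit_sum \<beta> y n"
    by (auto simp: same_prefix_def digit_sum_def intro!: sum.cong)
next
  assume sums: "\<forall>n\<le>N. digit_sum \<beta> x n = digit_sum \<beta> y n"
  show "same_prefix \<beta> N x y"
    unfolding same_prefix_def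
  proof clarify
    fix i assume "i < N"
    then show "dbar \<beta> x i = dbar \<beta> y i"
      using sums[rule_format, of i] sums[rule_format, of "Suc i"] by (simp add: digit_sum_Suc)
  qed
qed

lemma same_prefix_trans:
  "same_prefix \<beta> N x y \<Longrightarrow> same_prefix \<beta> N y z \<Longrightarrow> same_prefix \<beta> N x z"
  by (simp add: same_prefix_def)

lemma same_prefix_Suc:
  "same_prefix \<beta> (Suc N) x y \<longleftrightarrow>
    dbar \<beta> x 0 = dbar \<beta> y 0 \<and> same_prefix \<beta> N (Tbar \<beta> x) (Tbar \<beta> y)"
  by (simp add: same_prefix_def All_less_Suc2 dbar_Suc)

lemma same_prefix_funpow:
  "same_prefix \<beta> (m + N) x y \<Longrightarrow> same_prefix \<beta> N ((Tbar \<beta> ^^ m) x) ((Tbar \<beta> ^^ m) y)"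
  by (simp add: same_prefix_def dbar_funpow)

lemma dist_le_of_same_prefix:
  assumes "1 < \<beta>" "x \<in> {0<..1}" "y \<in> {0<..1}" "same_prefix \<beta> N x y"
  shows "dist x y \<le> (1 / \<beta>) ^ N"
proof -
  have "(\<Sum>i<N. of_int (dbar \<beta> x i) / \<beta> ^ Suc i) = (\<Sum>i<N. of_int (dbar \<beta> y i) / \<beta> ^ Suc i)"
    using assms(4) by (intro sum.cong) (auto simp: same_prefix_def)
  then have "x - y = ((Tbar \<beta> ^^ N) x - (Tbar \<beta> ^^ N) y) / \<beta> ^ N"
    using dbar_expansion[OF assms(1), of x N] dbar_expansion[OF assms(1), of y N]
    by (simp add: diff_divide_distrib)
  moreover have "\<bar>(Tbar \<beta> ^^ N) x - (Tbar \<beta> ^^ N) y\<bar> \<le> 1"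
    using funpow_Tbar_bounds[OF assms(2), of N \<beta>] funpow_Tbar_bounds[OF assms(3), of N \<beta>]
    by auto
  ultimately show ?thesis
    using assms(1) by (simp add: dist_real_def power_one_over divide_right_mono)
qed

definition recurrent :: "real \<Rightarrow> real \<Rightarrow> bool" where
  "recurrent \<beta> x \<longleftrightarrow> (\<forall>N. \<exists>k>0. same_prefix \<beta> N ((Tbar \<beta> ^^ k) x) x)"

lemma recurrent_infinitely_often:
  assumes "recurrent \<beta> x"
  shows "infinite {k. same_prefix \<beta> N ((Tbar \<beta> ^^ k) x) x}"
  unfolding infinite_nat_iff_unbounded
proof
  fix K
  show "\<exists>k>K. k \<in> {k. same_prefix \<beta> N ((Tbar \<beta> ^^ k) x) x}"
  proof (induction K)
    case 0
    then show ?case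
      using assms by (simp add: recurrent_def)
  next
    case (Suc K)
    then obtain k where k: "K < k" "same_prefix \<beta> N ((Tbar \<beta> ^^ k) x) x"
      by blast
    obtain j where j: "0 < j" "same_prefix \<beta> (k + N) ((Tbar \<beta> ^^ j) x) x"
      using assms unfolding recurrent_def by blast
    have "same_prefix \<beta> N ((Tbar \<beta> ^^ (k + j)) x) x"
      using same_prefix_trans[OF same_prefix_funpow[OF j(2)] k(2)] by (simp add: funpow_add)
    then show ?case
      using k(1) j(1) by (intro exI[of _ "k + j"]) simp
  qed
qed

lemma orbit_mem_orbit_closure: "(Tbar \<beta> ^^ n) x \<in> orbit_closure \<beta> x"
  unfolding orbit_closure_def by (rule subsetD[OF closure_subset]) simp

lemma self_mem_orbit_closure: "x \<in> orbit_closure \<beta> x"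
  using orbit_mem_orbit_closure[of 0] by simp

lemma mem_orbit_closure_of_periodic:
  assumes "0 < q" "(Tbar \<beta> ^^ q) x = x" "y \<in> orbit_closure \<beta> x"
  shows "x \<in> orbit_closure \<beta> y"
proof -
  have "range (\<lambda>n. (Tbar \<beta> ^^ n) x) = (\<lambda>n. (Tbar \<beta> ^^ n) x) ` {..<q}"
    using funpow_mod_eq[OF assms(2)] assms(1)
    by (auto intro!: image_eqI[of _ _ "_ mod q"])
  then have "orbit_closure \<beta> x = (\<lambda>n. (Tbar \<beta> ^^ n) x) ` {..<q}"
    by (simp add: orbit_closure_def finite_imp_closed)
  then obtain k where k: "k < q" "y = (Tbar \<beta> ^^ k) x"
    using assms(3) by auto
  then have "(Tbar \<beta> ^^ (q - k)) y = x"
    using assms(2) by (simp flip: funpow_add comp_apply[of "Tbar \<beta> ^^ (q - k)"])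
  then show ?thesis
    using orbit_mem_orbit_closure by metis
qed

section \<open>Orbits staying in a closed set away from zero\<close>

locale closed_window =
  fixes \<beta> c :: real and J :: "real set"
  assumes beta_gt_1: "1 < \<beta>" and c_pos: "0 < c" and closed_J: "closed J" and J_subset: "J \<subseteq> {c..1}"
begin

definition stays :: "real \<Rightarrow> bool" where
  "stays x \<longleftrightarrow> (\<forall>n. (Tbar \<beta> ^^ n) x \<in> J)"

lemma J_bounds: "x \<in> J \<Longrightarrow> x \<in> {0<..1}"
  using c_pos J_subset by force

lemma stays_in_J: "stays x \<Longrightarrow> x \<in> J"
  unfolding stays_def by (metis funpow_0)

lemma stays_bounds: "stays x \<Longrightarrow> x \<in> {0<..1}"
  using stays_in_J J_bounds by blast

lemma stays_funpow: "stays x \<Longrightarrow> stays ((Tbar \<beta> ^^ n) x)"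
  unfolding stays_def by (metis comp_apply funpow_add)

lemma stays_Tbar: "stays x \<Longrightarrow> stays (Tbar \<beta> x)"
  using stays_funpow[of x 1] by simp

lemma stays_of_forward_invariant:
  assumes "S \<subseteq> J" "Tbar \<beta> ` S \<subseteq> S" "x \<in> S"
  shows "stays x"
proof -
  have "(Tbar \<beta> ^^ n) x \<in> S" for n
    by (induction n) (use assms in auto)
  then show ?thesis
    using assms(1) unfolding stays_def by blast
qed

lemma same_digit_of_close:
  assumes "stays x" "stays y" "dist x y < c / \<beta>"
  shows "dbar \<beta> x 0 = dbar \<beta> y 0"
proof -
  have no_jump: "\<not> dbar \<beta> u 0 < dbar \<beta> v 0" if "stays v" "dist u v < c / \<beta>" for u v
  proof
    assume "dbar \<beta> u 0 < dbar \<beta> v 0"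
    then have "c \<le> \<beta> * (v - u)"
      using Tbar_le_of_dbar_less[of \<beta> u v] stays_in_J[OF stays_Tbar[OF that(1)]] J_subset
      by fastforce
    also have "\<dots> \<le> \<beta> * dist u v"
      using beta_gt_1 by (intro mult_left_mono) (auto simp: dist_real_def)
    also have "\<dots> < c"
      using that(2) beta_gt_1 by (simp add: field_simps)
    finally show False
      by simp
  qed
  show ?thesis
    using no_jump[of x y] no_jump[of y x] assms by (simp add: dist_commute)
qed

lemma dist_Tbar_of_close:
  assumes "stays x" "stays y" "dist x y < c / \<beta>"
  shows "dist (Tbar \<beta> x) (Tbar \<beta> y) = \<beta> * dist x y"
  using same_digit_of_close[OF assms] beta_gt_1
  by (simp add: dist_real_def Tbar_eq abs_mult flip: right_diff_distrib)

lemma same_prefix_of_close: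
  assumes "stays x" "stays y" "dist x y < c / \<beta> ^ N"
  shows "same_prefix \<beta> N x y"
  using assms
proof (induction N arbitrary: x y)
  case 0
  then show ?case
    by (simp add: same_prefix_def)
next
  case (Suc N)
  have "c / \<beta> ^ Suc N \<le> c / \<beta>"
    using beta_gt_1 c_pos one_le_power[of \<beta> N] by (simp add: field_simps)
  then have close: "dist x y < c / \<beta>"
    using Suc.prems by linarith
  have "dist (Tbar \<beta> x) (Tbar \<beta> y) < c / \<beta> ^ N"
    using Suc.prems(3) beta_gt_1
    by (simp add: dist_Tbar_of_close[OF Suc.prems(1,2) close] field_simps)
  then show ?case
    using Suc.IH Suc.prems stays_Tbar same_digit_of_close[OF Suc.prems(1,2) close]
    by (simp add: same_prefix_Suc)
qed

lemma continuous_on_Tbar: "continuous_on {x. stays x} (Tbar \<beta>)"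
  unfolding continuous_on_iff
proof clarify
  fix x and e :: real assume stays_x: "stays x" and "0 < e"
  then have "0 < min (e / \<beta>) (c / \<beta>)"
    using beta_gt_1 c_pos by simp
  moreover have "dist (Tbar \<beta> z) (Tbar \<beta> x) < e" if "stays z" "dist z x < min (e / \<beta>) (c / \<beta>)" for z
    using dist_Tbar_of_close[OF that(1) stays_x] that(2) beta_gt_1 by (simp add: field_simps)
  ultimately show "\<exists>d>0. \<forall>z\<in>{x. stays x}. dist z x < d \<longrightarrow> dist (Tbar \<beta> z) (Tbar \<beta> x) < e"
    by blast
qed

text \<open>The first digits along a convergent sequence of staying points are eventually constant, and
  the limit inherits them because \<open>J\<close> is closed and avoids \<open>0\<close>.\<close>
lemma tendsto_Tbar:
  assumes "\<And>n. stays (f n)" "f \<longlonglongrightarrow> x"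
  shows "(\<lambda>n. Tbar \<beta> (f n)) \<longlonglongrightarrow> Tbar \<beta> x"
proof -
  have "Cauchy f"
    using assms(2) by (intro LIMSEQ_imp_Cauchy)
  moreover have "0 < c / \<beta>"
    using beta_gt_1 c_pos by simp
  ultimately obtain M where "\<And>n. M \<le> n \<Longrightarrow> dist (f n) (f M) < c / \<beta>"
    unfolding Cauchy_altdef2 by blast
  then have "Tbar \<beta> (f n) = \<beta> * f n - of_int (dbar \<beta> (f M) 0)" if "M \<le> n" for n
    using same_digit_of_close[OF assms(1,1)] that by (simp add: Tbar_eq)
  then have "\<forall>\<^sub>F n in sequentially. \<beta> * f n - of_int (dbar \<beta> (f M) 0) = Tbar \<beta> (f n)"
    unfolding eventually_sequentially by (intro exI[of _ M]) simp
  moreover have "(\<lambda>n. \<beta> * f n - of_int (dbar \<beta> (f M) 0)) \<longlonglongrightarrow> \<beta> * x - of_int (dbar \<beta> (f M) 0)"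
    using assms(2) by (intro tendsto_intros)
  ultimately have lim: "(\<lambda>n. Tbar \<beta> (f n)) \<longlonglongrightarrow> \<beta> * x - of_int (dbar \<beta> (f M) 0)"
    by (rule Lim_transform_eventually[rotated])
  have "\<beta> * x - of_int (dbar \<beta> (f M) 0) \<in> J"
    using stays_in_J[OF stays_Tbar[OF assms(1)]]
    by (rule closed_sequentially[OF closed_J _ lim])
  then have Tbar_limit: "Tbar \<beta> x = \<beta> * x - of_int (dbar \<beta> (f M) 0)"
    by (intro Tbar_dbar_unique(2) J_bounds)
  show ?thesis
    unfolding Tbar_limit by (rule lim)
qed

lemma closed_stays: "closed {x. stays x}"
proof -
  have "stays x" if "x \<in> closure {x. stays x}" for x
  proof (rule stays_of_forward_invariant[OF _ _ that])
    show "closure {x. stays x} \<subseteq> J"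
      using closed_J stays_in_J by (intro closure_minimal) auto
    show "Tbar \<beta> ` closure {x. stays x} \<subseteq> closure {x. stays x}"
    proof clarify
      fix x assume "x \<in> closure {x. stays x}"
      then obtain f where "\<And>n. stays (f n)" "f \<longlonglongrightarrow> x"
        by (auto simp: closure_sequential)
      then show "Tbar \<beta> x \<in> closure {x. stays x}"
        using tendsto_Tbar stays_Tbar unfolding closure_sequential
        by (intro exI[of _ "\<lambda>n. Tbar \<beta> (f n)"]) auto
    qed
  qed
  then show ?thesis
    by (auto simp flip: closure_subset_eq)
qed

lemma stays_orbit_closure:
  assumes "stays x" "v \<in> orbit_closure \<beta> x"
  shows "stays v"
proof -
  have "orbit_closure \<beta> x \<subseteq> {v. stays v}"
    unfolding orbit_closure_def using closed_stays stays_funpow[OF assms(1)]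
    by (intro closure_minimal) auto
  then show ?thesis
    using assms(2) by blast
qed

lemma Tbar_orbit_closure_subset:
  assumes "stays x"
  shows "Tbar \<beta> ` orbit_closure \<beta> x \<subseteq> orbit_closure \<beta> x"
proof -
  have "continuous_on (closure (range (\<lambda>n. (Tbar \<beta> ^^ n) x))) (Tbar \<beta>)"
    using stays_orbit_closure[OF assms]
    by (intro continuous_on_subset[OF continuous_on_Tbar]) (auto simp: orbit_closure_def)
  then show ?thesis
    using orbit_mem_orbit_closure[of "Suc _" \<beta> x]
    unfolding orbit_closure_def by (intro image_closure_subset) auto
qed

lemma orbit_closure_mono:
  assumes "stays x" "v \<in> orbit_closure \<beta> x"
  shows "orbit_closure \<beta> v \<subseteq> orbit_closure \<beta> x"
proof -
  have "(Tbar \<beta> ^^ n) v \<in> orbit_closure \<beta> x" for n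
    by (induction n) (use assms Tbar_orbit_closure_subset in auto)
  then show ?thesis
    unfolding orbit_closure_def[of \<beta> v]
    by (intro closure_minimal) (auto simp: orbit_closure_def)
qed

lemma compact_orbit_closure:
  assumes "stays x"
  shows "compact (orbit_closure \<beta> x)"
proof -
  have "orbit_closure \<beta> x \<subseteq> {c..1}"
    using stays_in_J stays_orbit_closure[OF assms] J_subset by blast
  then show ?thesis
    unfolding compact_eq_bounded_closed
    using bounded_subset[OF bounded_closed_interval] by (auto simp: orbit_closure_def)
qed

lemma mem_closure_orbit_iff_same_prefix:
  assumes "stays x" "stays v"
  shows "v \<in> closure ((\<lambda>n. (Tbar \<beta> ^^ n) x) ` A) \<longleftrightarrow>
    (\<forall>N. \<exists>n\<in>A. same_prefix \<beta> N ((Tbar \<beta> ^^ n) x) v)"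
proof
  assume in_closure: "v \<in> closure ((\<lambda>n. (Tbar \<beta> ^^ n) x) ` A)"
  show "\<forall>N. \<exists>n\<in>A. same_prefix \<beta> N ((Tbar \<beta> ^^ n) x) v"
  proof
    fix N
    have "0 < c / \<beta> ^ N"
      using beta_gt_1 c_pos by simp
    then obtain n where "n \<in> A" "dist ((Tbar \<beta> ^^ n) x) v < c / \<beta> ^ N"
      using in_closure unfolding closure_approachable by blast
    then show "\<exists>n\<in>A. same_prefix \<beta> N ((Tbar \<beta> ^^ n) x) v"
      using same_prefix_of_close[OF stays_funpow[OF assms(1)] assms(2)] by blast
  qed
next
  assume prefixes: "\<forall>N. \<exists>n\<in>A. same_prefix \<beta> N ((Tbar \<beta> ^^ n) x) v"
  show "v \<in> closure ((\<lambda>n. (Tbar \<beta> ^^ n) x) ` A)"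
    unfolding closure_approachable
  proof clarify
    fix e :: real assume "0 < e"
    then obtain N where N: "(1 / \<beta>) ^ N < e"
      using real_arch_pow_inv[of e "1 / \<beta>"] beta_gt_1 by auto
    obtain n where n: "n \<in> A" "same_prefix \<beta> N ((Tbar \<beta> ^^ n) x) v"
      using prefixes by blast
    have "dist ((Tbar \<beta> ^^ n) x) v \<le> (1 / \<beta>) ^ N"
      using n(2) stays_bounds[OF stays_funpow[OF assms(1)]] stays_bounds[OF assms(2)]
      by (intro dist_le_of_same_prefix beta_gt_1)
    then show "\<exists>u\<in>(\<lambda>n. (Tbar \<beta> ^^ n) x) ` A. dist u v < e"
      using N n(1) by force
  qed
qed

lemma mem_orbit_closure_iff_same_prefix:
  assumes "stays x" "stays v"
  shows "v \<in> orbit_closure \<beta> x \<longleftrightarrow> (\<forall>N. \<exists>n. same_prefix \<beta> N ((Tbar \<beta> ^^ n) x) v)"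
  using mem_closure_orbit_iff_same_prefix[OF assms, of UNIV] by (simp add: orbit_closure_def)

lemma recurrent_of_Tbar_invariant:
  assumes "stays x" "Tbar_invariant \<beta> (orbit_closure \<beta> x)"
  shows "recurrent \<beta> x"
  unfolding recurrent_def
proof
  fix N
  obtain w where w: "w \<in> orbit_closure \<beta> x" "x = Tbar \<beta> w"
    using assms(2) self_mem_orbit_closure unfolding Tbar_invariant_def by blast
  obtain n where "same_prefix \<beta> (Suc N) ((Tbar \<beta> ^^ n) x) w"
    using w(1) mem_orbit_closure_iff_same_prefix[OF assms(1) stays_orbit_closure[OF assms(1) w(1)]]
    by blast
  then have "same_prefix \<beta> N ((Tbar \<beta> ^^ Suc n) x) x"
    using w(2) by (simp add: same_prefix_Suc)
  then show "\<exists>k>0. same_prefix \<beta> N ((Tbar \<beta> ^^ k) x) x"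
    by blast
qed

lemma Tbar_invariant_of_recurrent:
  assumes "stays x" "recurrent \<beta> x"
  shows "Tbar_invariant \<beta> (orbit_closure \<beta> x)"
proof -
  let ?S = "orbit_closure \<beta> x" and ?O = "\<lambda>n. (Tbar \<beta> ^^ n) x"
  have closed: "closed (Tbar \<beta> ` ?S)"
    using continuous_on_Tbar stays_orbit_closure[OF assms(1)] compact_orbit_closure[OF assms(1)]
    by (intro compact_imp_closed compact_continuous_image) (auto elim: continuous_on_subset)
  have "?O ` {0<..} \<subseteq> Tbar \<beta> ` ?S"
    using orbit_mem_orbit_closure[of _ \<beta> x] by (auto simp: gr0_conv_Suc)
  moreover have "x \<in> closure (?O ` {0<..})"
    using assms(2) unfolding mem_closure_orbit_iff_same_prefix[OF assms(1,1)] recurrent_def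
    by (simp add: Bex_def)
  ultimately have "?O n \<in> Tbar \<beta> ` ?S" for n
    using closure_minimal[OF _ closed, of "?O ` {0<..}"] by (cases "n = 0") auto
  then have "?S \<subseteq> Tbar \<beta> ` ?S"
    unfolding orbit_closure_def[of \<beta> x] using closed
    by (intro closure_minimal) (auto simp: orbit_closure_def)
  then show ?thesis
    using Tbar_orbit_closure_subset[OF assms(1)] by (auto simp: Tbar_invariant_def)
qed

end

section \<open>Windows of length at most \<open>1 / \<beta>\<close>\<close>

locale short_window = closed_window +
  assumes J_diam: "x \<in> J \<Longrightarrow> y \<in> J \<Longrightarrow> \<beta> * (y - x) \<le> 1"
begin

text \<open>For the circle map, the two alternatives say that the lifts of the two orbits stay ordered and
  at distance at most one.\<close>
lemma digit_sum_order:
  assumes "stays x" "stays y" "x \<le> y"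
  shows "digit_sum \<beta> y n = digit_sum \<beta> x n \<and> (Tbar \<beta> ^^ n) x \<le> (Tbar \<beta> ^^ n) y \<or>
    digit_sum \<beta> y n = digit_sum \<beta> x n + 1 \<and> (Tbar \<beta> ^^ n) y \<le> (Tbar \<beta> ^^ n) x"
proof (induction n)
  case 0
  then show ?case
    using assms(3) by simp
next
  case (Suc n)
  have in_J: "(Tbar \<beta> ^^ n) x \<in> J" "(Tbar \<beta> ^^ n) y \<in> J"
    using assms(1,2) by (auto simp: stays_def)
  from Suc show ?case
  proof (elim disjE conjE)
    assume "digit_sum \<beta> y n = digit_sum \<beta> x n" "(Tbar \<beta> ^^ n) x \<le> (Tbar \<beta> ^^ n) y"
    then show ?thesis
      using Tbar_step_order[OF beta_gt_1 _ J_diam[OF in_J]] by (simp add: digit_sum_Suc dbar_funpow)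
  next
    assume "digit_sum \<beta> y n = digit_sum \<beta> x n + 1" "(Tbar \<beta> ^^ n) y \<le> (Tbar \<beta> ^^ n) x"
    then show ?thesis
      using Tbar_step_order[OF beta_gt_1 _ J_diam[OF in_J(2,1)]]
      by (auto simp: digit_sum_Suc dbar_funpow)
  qed
qed

lemma digit_sum_mono:
  "stays x \<Longrightarrow> stays y \<Longrightarrow> x \<le> y \<Longrightarrow> digit_sum \<beta> x n \<le> digit_sum \<beta> y n"
  using digit_sum_order[of x y n] by auto

lemma digit_sum_diff_le_1:
  "stays x \<Longrightarrow> stays y \<Longrightarrow> \<bar>digit_sum \<beta> x n - digit_sum \<beta> y n\<bar> \<le> 1"
  using digit_sum_order[of x y n] digit_sum_order[of y x n] by (cases "x \<le> y") auto

end

section \<open>Mechanical words\<close>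

lemma sum_upper_mechanical: "(\<Sum>k<n. upper_mechanical \<alpha> k) = \<lceil>\<alpha> * real n\<rceil>"
  by (induction n) (simp_all add: upper_mechanical_def add.commute)

lemma sum_lower_mechanical: "(\<Sum>k<n. lower_mechanical \<alpha> k) = \<lfloor>\<alpha> * real n\<rfloor>"
  by (induction n) (simp_all add: lower_mechanical_def add.commute)

lemma upper_mechanical_of_int: "upper_mechanical (of_int d) = (\<lambda>_. d)"
proof
  fix n
  have "\<lceil>of_int d * real m\<rceil> = d * int m" for m
    using ceiling_of_int[of "d * int m", where 'a = real] by simp
  from this[of "Suc n"] this[of n] show "upper_mechanical (of_int d) n = d"
    by (simp add: upper_mechanical_def algebra_simps)
qed

lemma dbar_eq_upper_mechanical_iff:
  "dbar \<beta> x = upper_mechanical \<alpha> \<longleftrightarrow> (\<forall>n. digit_sum \<beta> x n = \<lceil>\<alpha> * real n\<rceil>)"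
proof
  assume sums: "\<forall>n. digit_sum \<beta> x n = \<lceil>\<alpha> * real n\<rceil>"
  show "dbar \<beta> x = upper_mechanical \<alpha>"
  proof
    fix n
    show "dbar \<beta> x n = upper_mechanical \<alpha> n"
      using sums[rule_format, of n] sums[rule_format, of "Suc n"]
      by (simp add: digit_sum_Suc upper_mechanical_def add.commute)
  qed
qed (simp add: digit_sum_def sum_upper_mechanical)

lemma irrational_multiple_notin_Ints:
  fixes \<alpha> :: real
  assumes "\<alpha> \<notin> \<rat>" "0 < m"
  shows "\<alpha> * real m \<notin> \<int>"
proof
  assume "\<alpha> * real m \<in> \<int>"
  then have "\<alpha> * real m / real m \<in> \<rat>"
    by (meson Ints_subset_Rats Rats_divide Rats_of_nat subsetD)
  then show False
    using assms by simp
qed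

lemma ceiling_eq_floor_add_1_of_irrational:
  fixes \<alpha> :: real
  assumes "\<alpha> \<notin> \<rat>" "0 < m"
  shows "\<lceil>\<alpha> * real m\<rceil> = \<lfloor>\<alpha> * real m\<rfloor> + 1"
  using irrational_multiple_notin_Ints[OF assms] by (metis Ints_of_int ceiling_altdef)

lemma inj_frac_irrational_multiple:
  fixes \<alpha> :: real
  assumes "\<alpha> \<notin> \<rat>"
  shows "inj (\<lambda>m. frac (\<alpha> * real m))"
proof (rule linorder_injI)
  fix m n :: nat assume "m < n"
  then have "\<alpha> * real (n - m) \<notin> \<int>"
    by (intro irrational_multiple_notin_Ints[OF assms]) simp
  moreover have "\<alpha> * real (n - m) = of_int (\<lfloor>\<alpha> * real n\<rfloor> - \<lfloor>\<alpha> * real m\<rfloor>)"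
    if "frac (\<alpha> * real m) = frac (\<alpha> * real n)"
    using that \<open>m < n\<close> by (simp add: frac_def of_nat_diff right_diff_distrib)
  ultimately show "frac (\<alpha> * real m) \<noteq> frac (\<alpha> * real n)"
    by (metis Ints_of_int)
qed

lemma irrational_multiple_separates:
  fixes \<theta> :: real and A B :: "real set"
  assumes "\<theta> \<notin> \<rat>" "finite A" "finite B"
    and "\<And>b. b \<in> B \<Longrightarrow> b < 1" "\<And>a. a \<in> A \<Longrightarrow> 0 < a" "\<And>a b. a \<in> A \<Longrightarrow> b \<in> B \<Longrightarrow> b < a"
  obtains k :: nat where "0 < k"
    "\<And>b. b \<in> B \<Longrightarrow> b < frac (\<theta> * real k)" "\<And>a. a \<in> A \<Longrightarrow> frac (\<theta> * real k) < a"
proof -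
  define l h where "l = Max (insert 0 B)" and "h = Min (insert 1 A)"
  have lower: "0 \<le> l" "\<And>b. b \<in> B \<Longrightarrow> b \<le> l" and upper: "h \<le> 1" "\<And>a. a \<in> A \<Longrightarrow> h \<le> a"
    using assms(2,3) by (auto simp: l_def h_def)
  have "l < h"
    using assms(2-6) by (auto simp: l_def h_def)
  obtain k where k: "0 < k" "\<bar>frac (real k * \<theta>) - (l + h) / 2\<bar> < (h - l) / 2"
    using Kronecker_approx_1_explicit[OF assms(1), of "(l + h) / 2" "(h - l) / 2"]
      upper(1) lower(1) \<open>l < h\<close>
    by auto
  then have "l < frac (\<theta> * real k)" "frac (\<theta> * real k) < h"
    unfolding mult.commute[of \<theta>] by (simp_all add: abs_less_iff field_simps)
  then show thesis
    using upper(2) lower(2) k(1) by (intro that[of k]) fastforce+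
qed

lemma rational_multiple_in_Ints:
  fixes \<alpha> :: real
  assumes "\<alpha> \<in> \<rat>"
  obtains p :: int and q :: nat where "0 < q" "\<alpha> * real q = of_int p"
proof -
  obtain p :: int and q :: nat where "q \<noteq> 0" "\<alpha> = of_int p / real q"
    using assms by (auto simp: Rats_eq_int_div_nat)
  then show thesis
    by (intro that[of q p]) auto
qed

lemma ceiling_divide_of_int:
  fixes p q :: int
  assumes "0 < q"
  shows "\<lceil>of_int p / of_int q :: real\<rceil> = (p - 1) div q + 1"
proof (rule ceiling_unique)
  define r where "r = (p - 1) mod q + 1"
  have "p = q * ((p - 1) div q) + r"
    using mult_div_mod_eq[of q "p - 1"] by (simp add: r_def)
  then have "real_of_int p = of_int q * of_int ((p - 1) div q) + of_int r"
    by (metis of_int_add of_int_mult)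
  moreover have "0 < r" "r \<le> q"
    using assms pos_mod_sign[of q "p - 1"] pos_mod_bound[of q "p - 1"] unfolding r_def by linarith+
  ultimately show "of_int ((p - 1) div q + 1) - 1 < of_int p / (of_int q :: real)"
    "of_int p / (of_int q :: real) \<le> of_int ((p - 1) div q + 1)"
    using assms by (simp_all add: field_simps)
qed

text \<open>For \<open>\<alpha> = p / q\<close> in lowest terms, choose \<open>k\<close> with \<open>p k \<equiv> -1\<close> modulo \<open>q\<close>.\<close>
lemma rational_ceiling_eq_floor_shift:
  fixes \<alpha> :: real
  assumes "\<alpha> \<in> \<rat>"
  obtains k :: nat where "\<And>n. \<lfloor>\<alpha> * real (k + n)\<rfloor> - \<lfloor>\<alpha> * real k\<rfloor> = \<lceil>\<alpha> * real n\<rceil>"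
proof -
  obtain p q :: int where pq: "0 < q" "coprime p q" "\<alpha> = of_int p / of_int q"
    using assms by (rule Rats_cases')
  obtain u v where "u * p + v * q = 1"
    using bezout_int[of p q] pq(2) by (metis coprime_imp_gcd_eq_1)
  define k where "k = nat ((- u) mod q)"
  define m where "m = v - p * ((- u) div q)"
  have int_k: "int k = - u - q * ((- u) div q)"
    using pq(1) by (simp add: k_def minus_mult_div_eq_mod)
  have "p * int k = q * m - 1"
    unfolding int_k m_def using \<open>u * p + v * q = 1\<close> by (simp add: algebra_simps)
  then have shift: "p * int (k + n) = q * m + (p * int n - 1)" for n
    by (simp add: distrib_left)
  have floor: "\<lfloor>\<alpha> * real j\<rfloor> = (p * int j) div q" for j
    using floor_divide_of_int_eq[of "p * int j" q, where 'a = real] by (simp add: pq(3))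
  have ceiling: "\<lceil>\<alpha> * real j\<rceil> = (p * int j - 1) div q + 1" for j
    using ceiling_divide_of_int[OF pq(1), of "p * int j"] by (simp add: pq(3))
  have "\<lfloor>\<alpha> * real (k + n)\<rfloor> = m + \<lceil>\<alpha> * real n\<rceil> - 1" for n
    unfolding floor ceiling shift using pq(1) by simp
  from this this[of 0] show thesis
    by (intro that[of k]) simp
qed

lemma finite_nonzero_of_bounded_sums:
  fixes f :: "nat \<Rightarrow> int"
  assumes "\<And>k. 0 \<le> f k" "\<And>K. (\<Sum>k<K. f k) \<le> C"
  shows "finite {k. f k \<noteq> 0}"
proof -
  have "card G \<le> nat C" if G: "G \<subseteq> {k. f k \<noteq> 0}" "finite G" for G
  proof -
    obtain K where K: "G \<subseteq> {..<K}"
      using finite_nat_bounded[OF G(2)] by blast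
    have "1 \<le> f k" if "k \<in> G" for k
      using assms(1)[of k] G(1) that by fastforce
    then have "int (card G) \<le> (\<Sum>k\<in>G. f k)"
      using sum_mono[of G "\<lambda>_. 1" f] by simp
    also have "\<dots> \<le> (\<Sum>k<K. f k)"
      using K assms(1) by (intro sum_mono2) auto
    also have "\<dots> \<le> C"
      by (rule assms(2))
    finally show ?thesis
      by simp
  qed
  then show ?thesis
    using finite_if_finite_subsets_card_bdd by blast
qed

section \<open>Orbit closures in a window containing a mechanical point\<close>

locale mechanical_point = short_window +
  fixes y \<alpha> :: real
  assumes stays_y: "stays y" and dbar_y: "dbar \<beta> y = upper_mechanical \<alpha>"
begin

lemma digit_sum_y: "digit_sum \<beta> y n = \<lceil>\<alpha> * real n\<rceil>"
  using dbar_y by (simp add: dbar_eq_upper_mechanical_iff)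

lemma digit_sum_orbit_y:
  "digit_sum \<beta> ((Tbar \<beta> ^^ k) y) n = \<lceil>\<alpha> * real (k + n)\<rceil> - \<lceil>\<alpha> * real k\<rceil>"
  using digit_sum_add[of \<beta> y k n] by (simp add: digit_sum_y)

lemma digit_sum_near_slope:
  assumes "stays x"
  shows "\<bar>of_int (digit_sum \<beta> x n) - \<alpha> * real n\<bar> \<le> 2"
proof -
  have "\<bar>digit_sum \<beta> x n - \<lceil>\<alpha> * real n\<rceil>\<bar> \<le> 1"
    using digit_sum_diff_le_1[OF assms stays_y, of n] by (simp add: digit_sum_y)
  then show ?thesis
    by linarith
qed

lemma sum_digit_sum_near_slope:
  assumes "stays x"
  shows "\<bar>(\<Sum>k<K. of_int (digit_sum \<beta> ((Tbar \<beta> ^^ k) x) n)) - real K * (\<alpha> * real n)\<bar> \<le> 2 * real n"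
proof -
  have "(\<Sum>k<K. of_int (digit_sum \<beta> ((Tbar \<beta> ^^ k) x) n)) - real K * (\<alpha> * real n)
      = (\<Sum>k<n. of_int (digit_sum \<beta> ((Tbar \<beta> ^^ k) x) K) - \<alpha> * real K)"
    using arg_cong[OF sum_digit_sum_orbit[of \<beta> x n K], of real_of_int]
    by (simp add: sum_subtractf)
  also have "\<bar>\<dots>\<bar> \<le> (\<Sum>k<n. \<bar>of_int (digit_sum \<beta> ((Tbar \<beta> ^^ k) x) K) - \<alpha> * real K\<bar>)"
    by (rule sum_abs)
  also have "\<dots> \<le> 2 * real n"
    using sum_bounded_above[of "{..<n}" _ "2 :: real"]
      digit_sum_near_slope[OF stays_funpow[OF assms]] by (simp add: mult.commute)
  finally show ?thesis .
qed

lemma average_digit_sum: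
  assumes "stays x"
  shows "(\<lambda>K. (\<Sum>k<K. of_int (digit_sum \<beta> ((Tbar \<beta> ^^ k) x) n)) / real K) \<longlonglongrightarrow> \<alpha> * real n"
proof (rule LIM_zero_cancel, rule Lim_null_comparison)
  show "(\<lambda>K. 2 * real n / real K) \<longlonglongrightarrow> 0"
    by (rule lim_const_over_n)
  have "norm ((\<Sum>k<K. of_int (digit_sum \<beta> ((Tbar \<beta> ^^ k) x) n)) / real K - \<alpha> * real n)
      \<le> 2 * real n / real K" if "0 < K" for K
    using sum_digit_sum_near_slope[OF assms, where n = n and K = K] that
    by (simp add: field_simps)
  then show "\<forall>\<^sub>F K in sequentially.
      norm ((\<Sum>k<K. of_int (digit_sum \<beta> ((Tbar \<beta> ^^ k) x) n)) / real K - \<alpha> * real n)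
        \<le> 2 * real n / real K"
    by (intro eventually_sequentiallyI[of 1]) auto
qed

lemma frequency_eq_slope:
  assumes "stays x"
  shows "has_frequency \<beta> x \<alpha>"
  using average_digit_sum[OF assms, of 1]
  by (simp add: has_frequency_def digit_sum_def dbar_funpow)

lemma slope_between_orbit_digit_sums:
  assumes "stays x" "\<And>k. digit_sum \<beta> ((Tbar \<beta> ^^ k) x) n \<in> {l..u}"
  shows "of_int l \<le> \<alpha> * real n" "\<alpha> * real n \<le> of_int u"
proof -
  let ?S = "\<lambda>K. \<Sum>k<K. real_of_int (digit_sum \<beta> ((Tbar \<beta> ^^ k) x) n)"
  have "real K * of_int l \<le> ?S K" "?S K \<le> real K * of_int u" for K
    using sum_bounded_below[of "{..<K}" "real_of_int l"]
      sum_bounded_above[of "{..<K}" _ "real_of_int u"] assms(2) by auto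
  then have "of_int l \<le> ?S K / real K" "?S K / real K \<le> of_int u" if "0 < K" for K
    using that by (simp_all add: field_simps)
  then show "of_int l \<le> \<alpha> * real n" "\<alpha> * real n \<le> of_int u"
    by (auto intro!: LIMSEQ_le_const[OF average_digit_sum[OF assms(1)]]
        LIMSEQ_le_const2[OF average_digit_sum[OF assms(1)]] exI[of _ 1])
qed

text \<open>The deviations from \<open>\<alpha> n\<close> along an orbit differ by at most one and hence have the same sign,
  so that their bounded partial sums allow only finitely many of them.\<close>
lemma finite_digit_sum_exceptions:
  assumes "stays x" "\<alpha> * real n = of_int p"
  shows "finite {k. digit_sum \<beta> ((Tbar \<beta> ^^ k) x) n \<noteq> p}"
proof (cases "\<exists>j. digit_sum \<beta> ((Tbar \<beta> ^^ j) x) n \<noteq> p")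
  case True
  define dev where "dev k = digit_sum \<beta> ((Tbar \<beta> ^^ k) x) n - p" for k
  obtain j where "dev j \<noteq> 0"
    using True by (auto simp: dev_def)
  define \<sigma> where "\<sigma> = sgn (dev j)"
  have \<sigma>: "\<bar>\<sigma>\<bar> = 1"
    using \<open>dev j \<noteq> 0\<close> by (simp add: \<sigma>_def abs_sgn_eq)
  have "\<bar>dev k - dev j\<bar> \<le> 1" for k
    using digit_sum_diff_le_1[OF stays_funpow stays_funpow] assms(1) by (simp add: dev_def)
  then have same_sign: "0 \<le> \<sigma> * dev k" for k
    using \<open>dev j \<noteq> 0\<close> abs_le_D1[of "dev k - dev j" 1] abs_le_D2[of "dev k - dev j" 1]
    by (simp add: \<sigma>_def sgn_if)
  have "(\<Sum>k<K. \<sigma> * dev k) \<le> 2 * int n" for K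
  proof -
    have "(\<Sum>k<K. \<sigma> * dev k) \<le> \<bar>\<Sum>k<K. dev k\<bar>"
      using \<sigma> abs_ge_self[of "\<sigma> * (\<Sum>k<K. dev k)"] by (simp add: abs_mult flip: sum_distrib_left)
    moreover have "real_of_int \<bar>\<Sum>k<K. dev k\<bar> \<le> 2 * real n"
      using sum_digit_sum_near_slope[OF assms(1), where n = n and K = K]
      by (simp add: dev_def assms(2) sum_subtractf)
    ultimately show ?thesis
      by linarith
  qed
  then have "finite {k. \<sigma> * dev k \<noteq> 0}"
    using same_sign by (intro finite_nonzero_of_bounded_sums)
  moreover have "\<sigma> \<noteq> 0"
    using \<sigma> by auto
  ultimately show ?thesis
    by (simp add: dev_def)
qed simp

lemma digit_sum_of_recurrent:
  assumes "stays x" "recurrent \<beta> x" "v \<in> orbit_closure \<beta> x" "\<alpha> * real n = of_int p"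
  shows "digit_sum \<beta> v n = p"
proof (rule ccontr)
  assume exception: "digit_sum \<beta> v n \<noteq> p"
  obtain m where m: "same_prefix \<beta> n ((Tbar \<beta> ^^ m) x) v"
    using assms(3) mem_orbit_closure_iff_same_prefix[OF assms(1) stays_orbit_closure[OF assms(1,3)]]
    by blast
  have "digit_sum \<beta> ((Tbar \<beta> ^^ (m + k)) x) n \<noteq> p"
    if "same_prefix \<beta> (m + n) ((Tbar \<beta> ^^ k) x) x" for k
    using same_prefix_trans[OF same_prefix_funpow[OF that] m] exception
    by (simp add: same_prefix_iff_digit_sum funpow_add)
  then have "(+) m ` {k. same_prefix \<beta> (m + n) ((Tbar \<beta> ^^ k) x) x}
      \<subseteq> {k. digit_sum \<beta> ((Tbar \<beta> ^^ k) x) n \<noteq> p}"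
    by blast
  then have "finite ((+) m ` {k. same_prefix \<beta> (m + n) ((Tbar \<beta> ^^ k) x) x})"
    using finite_digit_sum_exceptions[OF assms(1,4)] by (rule finite_subset)
  then show False
    using recurrent_infinitely_often[OF assms(2)] by (simp add: finite_image_iff)
qed

lemma digit_sum_le_ceiling:
  assumes "stays x" "recurrent \<beta> x" "v \<in> orbit_closure \<beta> x"
  shows "digit_sum \<beta> v n \<le> \<lceil>\<alpha> * real n\<rceil>"
proof (cases "\<alpha> * real n \<in> \<int>")
  case True
  then obtain p where "\<alpha> * real n = of_int p"
    by (auto elim: Ints_cases)
  then show ?thesis
    using digit_sum_of_recurrent[OF assms] by simp
next
  case False
  have stays_v: "stays v"
    using assms(1,3) by (rule stays_orbit_closure)
  have "digit_sum \<beta> ((Tbar \<beta> ^^ k) x) n \<in> {digit_sum \<beta> v n - 1..digit_sum \<beta> v n + 1}" for k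
    using digit_sum_diff_le_1[OF stays_v stays_funpow[OF assms(1)], of n k] by auto
  then have "of_int (digit_sum \<beta> v n - 1) \<le> \<alpha> * real n"
    using slope_between_orbit_digit_sums(1)[OF assms(1)] by blast
  moreover have "of_int (digit_sum \<beta> v n - 1) \<noteq> \<alpha> * real n"
    using False by (metis Ints_of_int)
  ultimately show ?thesis
    by linarith
qed

lemma orbit_closure_le_y:
  assumes "stays x" "recurrent \<beta> x" "v \<in> orbit_closure \<beta> x"
  shows "v \<le> y"
  using digit_sum_le_ceiling[OF assms] stays_orbit_closure[OF assms(1,3)] stays_y stays_bounds
  by (intro le_of_digit_sum_le[OF beta_gt_1]) (auto simp: digit_sum_y)

lemma y_mem_orbit_closure:
  assumes "stays x" "recurrent \<beta> x"
  shows "y \<in> orbit_closure \<beta> x"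
proof -
  obtain M where M: "M \<in> orbit_closure \<beta> x" "\<And>v. v \<in> orbit_closure \<beta> x \<Longrightarrow> v \<le> M"
    using compact_attains_sup[OF compact_orbit_closure[OF assms(1)]] self_mem_orbit_closure by blast
  have "stays M"
    using assms(1) M(1) by (rule stays_orbit_closure)
  have "\<lceil>\<alpha> * real n\<rceil> \<le> digit_sum \<beta> M n" for n
  proof -
    have "digit_sum \<beta> ((Tbar \<beta> ^^ k) x) n \<in> {digit_sum \<beta> M n - 1..digit_sum \<beta> M n}" for k
      using digit_sum_mono[OF stays_funpow[OF assms(1)] \<open>stays M\<close> M(2)[OF orbit_mem_orbit_closure]]
        digit_sum_diff_le_1[OF \<open>stays M\<close> stays_funpow[OF assms(1)], of n k]
      by (auto simp: abs_le_iff)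
    then have "\<alpha> * real n \<le> of_int (digit_sum \<beta> M n)"
      using slope_between_orbit_digit_sums(2)[OF assms(1)] by blast
    then show ?thesis
      by (simp add: ceiling_le_iff)
  qed
  then have "y \<le> M"
    using stays_y \<open>stays M\<close> stays_bounds
    by (intro le_of_digit_sum_le[OF beta_gt_1]) (auto simp: digit_sum_y)
  then have "M = y"
    using orbit_closure_le_y[OF assms M(1)] by simp
  then show ?thesis
    using M(1) by simp
qed

lemma mem_orbit_closure_y_of_rational:
  assumes "\<alpha> \<in> \<rat>" "stays x" "recurrent \<beta> x"
  shows "x \<in> orbit_closure \<beta> y"
proof -
  obtain p q where q: "0 < q" "\<alpha> * real q = of_int p"
    using assms(1) by (rule rational_multiple_in_Ints)
  have "digit_sum \<beta> ((Tbar \<beta> ^^ q) x) n = digit_sum \<beta> x n" for n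
    using digit_sum_add[of \<beta> x q n] digit_sum_add[of \<beta> x n q]
      digit_sum_of_recurrent[OF assms(2,3) orbit_mem_orbit_closure q(2), of n]
      digit_sum_of_recurrent[OF assms(2,3) self_mem_orbit_closure q(2)]
    by (simp add: add.commute)
  then have "(Tbar \<beta> ^^ q) x = x"
    using assms(2) stays_bounds stays_funpow by (intro eq_of_digit_sum_eq[OF beta_gt_1]) auto
  then show ?thesis
    by (rule mem_orbit_closure_of_periodic[OF q(1) _ y_mem_orbit_closure[OF assms(2,3)]])
qed

lemma digit_sum_orbit_y_irrational:
  assumes "\<alpha> \<notin> \<rat>" "0 < m"
  shows "digit_sum \<beta> ((Tbar \<beta> ^^ k) y) m =
    (if frac (- \<alpha> * real k) < frac (\<alpha> * real m) then \<lceil>\<alpha> * real m\<rceil> else \<lceil>\<alpha> * real m\<rceil> - 1)"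
proof -
  have "\<alpha> * real m = of_int \<lceil>\<alpha> * real m\<rceil> - 1 + frac (\<alpha> * real m)"
    using ceiling_eq_floor_add_1_of_irrational[OF assms] by (simp add: frac_def)
  moreover have "0 < frac (\<alpha> * real m)"
    using irrational_multiple_notin_Ints[OF assms] by (simp add: frac_gt_0_iff)
  moreover have "\<alpha> * real k = of_int \<lceil>\<alpha> * real k\<rceil> - frac (- \<alpha> * real k)"
    by (simp add: frac_def floor_minus)
  ultimately have "\<lceil>\<alpha> * real (k + m)\<rceil> = \<lceil>\<alpha> * real k\<rceil> +
    (if frac (- \<alpha> * real k) < frac (\<alpha> * real m) then \<lceil>\<alpha> * real m\<rceil> else \<lceil>\<alpha> * real m\<rceil> - 1)"
    using frac_lt_1[of "\<alpha> * real m"] frac_ge_0[of "- \<alpha> * real k"] frac_lt_1[of "- \<alpha> * real k"]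
    unfolding of_nat_add distrib_left by (intro ceiling_unique; split if_split; safe; linarith)
  then show ?thesis
    by (simp add: digit_sum_orbit_y)
qed

text \<open>Otherwise some orbit point of \<open>y\<close> would have a smaller digit sum than \<open>x\<close> at \<open>m\<close> and a larger
  one at \<open>n\<close>.\<close>
lemma digit_sum_thresholds_separated:
  assumes "\<alpha> \<notin> \<rat>" "stays x" "0 < m" "0 < n"
    and "digit_sum \<beta> x m = \<lceil>\<alpha> * real m\<rceil>" "digit_sum \<beta> x n = \<lceil>\<alpha> * real n\<rceil> - 1"
  shows "frac (\<alpha> * real n) < frac (\<alpha> * real m)"
proof (rule ccontr)
  assume "\<not> ?thesis"
  moreover have "m \<noteq> n"
    using assms(5,6) by auto
  then have "frac (\<alpha> * real m) \<noteq> frac (\<alpha> * real n)"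
    using inj_frac_irrational_multiple[OF assms(1)] by (auto dest: injD)
  ultimately have less: "frac (\<alpha> * real m) < frac (\<alpha> * real n)"
    by linarith
  obtain k where k: "frac (\<alpha> * real m) < frac (- \<alpha> * real k)"
      "frac (- \<alpha> * real k) < frac (\<alpha> * real n)"
  proof (rule irrational_multiple_separates[of "- \<alpha>" "{frac (\<alpha> * real n)}" "{frac (\<alpha> * real m)}"])
    show "0 < a" if "a \<in> {frac (\<alpha> * real n)}" for a
      using that less frac_ge_0[of "\<alpha> * real m"] unfolding singleton_iff by linarith
  qed (use assms(1) less in \<open>auto simp: frac_lt_1\<close>)
  have stays_iterate: "stays ((Tbar \<beta> ^^ k) y)"
    by (rule stays_funpow[OF stays_y])
  have "digit_sum \<beta> ((Tbar \<beta> ^^ k) y) m < digit_sum \<beta> x m"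
    using k(1) assms(5) by (simp add: digit_sum_orbit_y_irrational[OF assms(1,3)])
  moreover have "digit_sum \<beta> x n < digit_sum \<beta> ((Tbar \<beta> ^^ k) y) n"
    using k(2) assms(6) by (simp add: digit_sum_orbit_y_irrational[OF assms(1,4)])
  ultimately show False
    using digit_sum_mono[OF stays_iterate assms(2)] digit_sum_mono[OF assms(2) stays_iterate]
    by (metis linear not_le)
qed

lemma orbit_y_same_prefix_of_irrational:
  assumes "\<alpha> \<notin> \<rat>" "stays x" "x \<le> y"
  shows "\<exists>k>0. same_prefix \<beta> N ((Tbar \<beta> ^^ k) y) x"
proof -
  define f where "f m = frac (\<alpha> * real m)" for m
  define High where "High = {m \<in> {1..N}. digit_sum \<beta> x m = \<lceil>\<alpha> * real m\<rceil>}"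
  define Low where "Low = {m \<in> {1..N}. digit_sum \<beta> x m = \<lceil>\<alpha> * real m\<rceil> - 1}"
  have High_or_Low: "m \<in> High \<or> m \<in> Low" if "0 < m" "m \<le> N" for m
    using digit_sum_order[OF assms(2) stays_y assms(3), of m] that
    by (auto simp: High_def Low_def digit_sum_y)
  have f_pos: "0 < f m" if "m \<in> High" for m
    using irrational_multiple_notin_Ints[OF assms(1)] that
    by (simp add: f_def High_def frac_gt_0_iff)
  have separated: "f n < f m" if "m \<in> High" "n \<in> Low" for m n
    using digit_sum_thresholds_separated[OF assms(1,2)] that by (simp add: f_def High_def Low_def)
  obtain k where k: "0 < k" "\<And>n. n \<in> Low \<Longrightarrow> f n < frac (- \<alpha> * real k)"
      "\<And>m. m \<in> High \<Longrightarrow> frac (- \<alpha> * real k) < f m"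
  proof (rule irrational_multiple_separates[of "- \<alpha>" "f ` High" "f ` Low"])
    show "finite (f ` High)" "finite (f ` Low)"
      by (simp_all add: High_def Low_def)
  qed (use assms(1) f_pos separated in \<open>auto simp: f_def frac_lt_1\<close>)
  have "digit_sum \<beta> ((Tbar \<beta> ^^ k) y) m = digit_sum \<beta> x m" if "m \<le> N" for m
  proof (cases "m = 0")
    case False
    then consider (high) "m \<in> High" | (low) "m \<in> Low"
      using High_or_Low \<open>m \<le> N\<close> by blast
    then show ?thesis
    proof cases
      case high
      then show ?thesis
        using k(3)[OF high] by (simp add: digit_sum_orbit_y_irrational[OF assms(1)] f_def High_def)
    next
      case low
      then show ?thesis
        using k(2)[OF low] by (simp add: digit_sum_orbit_y_irrational[OF assms(1)] f_def Low_def)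
    qed
  qed simp
  then show ?thesis
    using k(1) by (auto simp: same_prefix_iff_digit_sum)
qed

lemma recurrent_y: "recurrent \<beta> y"
proof (cases "\<alpha> \<in> \<rat>")
  case True
  then obtain p q where q: "0 < q" "\<alpha> * real q = of_int p"
    by (rule rational_multiple_in_Ints)
  then have "digit_sum \<beta> ((Tbar \<beta> ^^ q) y) n = digit_sum \<beta> y n" for n
    by (simp add: digit_sum_orbit_y digit_sum_y distrib_left add.commute[of "of_int p"])
  then show ?thesis
    using q(1) by (auto simp: recurrent_def same_prefix_iff_digit_sum)
next
  case False
  then show ?thesis
    using orbit_y_same_prefix_of_irrational stays_y by (simp add: recurrent_def)
qed

lemma orbit_closure_eq_of_recurrent:
  assumes "stays x" "recurrent \<beta> x"
  shows "orbit_closure \<beta> x = orbit_closure \<beta> y"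
proof
  show "orbit_closure \<beta> y \<subseteq> orbit_closure \<beta> x"
    using assms y_mem_orbit_closure by (intro orbit_closure_mono)
  have "x \<in> orbit_closure \<beta> y"
  proof (cases "\<alpha> \<in> \<rat>")
    case True
    then show ?thesis
      using assms by (rule mem_orbit_closure_y_of_rational)
  next
    case False
    have "x \<le> y"
      using orbit_closure_le_y[OF assms self_mem_orbit_closure] .
    then show ?thesis
      using orbit_y_same_prefix_of_irrational[OF False assms(1)]
        mem_orbit_closure_iff_same_prefix[OF stays_y assms(1)] by blast
  qed
  then show "orbit_closure \<beta> x \<subseteq> orbit_closure \<beta> y"
    using stays_y by (intro orbit_closure_mono)
qed

lemma unique_invariant_orbit_closure_y:
  "unique_invariant_orbit_closure_in \<beta> J (orbit_closure \<beta> y)"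
  unfolding unique_invariant_orbit_closure_in_def
proof (intro allI iffI)
  fix S assume S: "is_orbit_closure \<beta> S \<and> Tbar_invariant \<beta> S \<and> S \<subseteq> J"
  then obtain x where x: "S = orbit_closure \<beta> x"
    by (auto simp: is_orbit_closure_def)
  have "stays x"
    using S self_mem_orbit_closure unfolding x Tbar_invariant_def
    by (intro stays_of_forward_invariant[of "orbit_closure \<beta> x"]) auto
  then show "S = orbit_closure \<beta> y"
    using S unfolding x by (intro orbit_closure_eq_of_recurrent recurrent_of_Tbar_invariant) auto
next
  fix S assume "S = orbit_closure \<beta> y"
  then show "is_orbit_closure \<beta> S \<and> Tbar_invariant \<beta> S \<and> S \<subseteq> J"
    using Tbar_invariant_of_recurrent[OF stays_y recurrent_y] stays_orbit_closure[OF stays_y]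
      stays_in_J stays_bounds[OF stays_y]
    by (auto simp: is_orbit_closure_def)
qed

theorem mechanical_orbit_closure:
  "let S = orbit_closure \<beta> (word_value \<beta> (upper_mechanical \<alpha>)) in
    S \<subseteq> J \<and> Tbar_invariant \<beta> S \<and>
    unique_invariant_orbit_closure_in \<beta> J S \<and> set_has_frequency \<beta> S \<alpha>"
proof -
  have "word_value \<beta> (upper_mechanical \<alpha>) = y"
    using word_value_dbar[OF beta_gt_1 stays_bounds[OF stays_y]] by (simp add: dbar_y)
  moreover have "set_has_frequency \<beta> (orbit_closure \<beta> y) \<alpha>"
    using frequency_eq_slope stays_orbit_closure[OF stays_y] by (simp add: set_has_frequency_def)
  ultimately show ?thesis
    using unique_invariant_orbit_closure_y
    unfolding unique_invariant_orbit_closure_in_def Let_def by metis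
qed

end

section \<open>Mechanical points in an interval of length \<open>1 / \<beta>\<close>\<close>

locale interval_window =
  fixes \<beta> t :: real
  assumes interval_beta_gt_1: "1 < \<beta>" and t_pos: "0 < t" and right_end_le_1: "t + 1 / \<beta> \<le> 1"
begin

sublocale short_window \<beta> t "{t..t + 1 / \<beta>}"
proof
  fix x y assume "x \<in> {t..t + 1 / \<beta>}" "y \<in> {t..t + 1 / \<beta>}"
  then have "\<beta> * (y - x) \<le> \<beta> * (1 / \<beta>)"
    using interval_beta_gt_1 by (intro mult_left_mono) auto
  then show "\<beta> * (y - x) \<le> 1"
    using interval_beta_gt_1 by simp
qed (use interval_beta_gt_1 t_pos right_end_le_1 in auto)

lemma ends_bounds: "t \<in> {0<..1}" "t + 1 / \<beta> \<in> {0<..1}"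
  using J_bounds[of t] J_bounds[of "t + 1 / \<beta>"] beta_gt_1 by auto

lemma dbar_Tbar_right_end:
  "dbar \<beta> (t + 1 / \<beta>) 0 = dbar \<beta> t 0 + 1" "Tbar \<beta> (t + 1 / \<beta>) = Tbar \<beta> t"
proof -
  have "\<beta> * (t + 1 / \<beta>) = \<beta> * t + 1"
    using beta_gt_1 by (simp add: field_simps)
  then show "dbar \<beta> (t + 1 / \<beta>) 0 = dbar \<beta> t 0 + 1" "Tbar \<beta> (t + 1 / \<beta>) = Tbar \<beta> t"
    by (simp_all add: Tbar_eq dbar_def)
qed

lemma dbar_right_end:
  assumes "dbar \<beta> t = case_nat a s"
  shows "dbar \<beta> (t + 1 / \<beta>) = case_nat (a + 1) s"
proof
  fix n
  show "dbar \<beta> (t + 1 / \<beta>) n = case_nat (a + 1) s n"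
    using dbar_Tbar_right_end assms dbar_Suc[of \<beta> t] by (cases n) (auto simp: dbar_Suc)
qed

lemma digit_sum_right_end:
  assumes "0 < n"
  shows "digit_sum \<beta> (t + 1 / \<beta>) n = digit_sum \<beta> t n + 1"
proof -
  obtain m where "n = 1 + m"
    using assms by (metis Suc_pred plus_1_eq_Suc)
  then show ?thesis
    by (simp only: digit_sum_add) (simp add: digit_sum_Suc dbar_Tbar_right_end)
qed

lemma stays_of_digit_sum_between:
  assumes "x \<in> {0<..1}"
    and "\<And>n m. 0 < m \<Longrightarrow> digit_sum \<beta> ((Tbar \<beta> ^^ n) x) m \<in> {digit_sum \<beta> t m..digit_sum \<beta> t m + 1}"
  shows "stays x"
  unfolding stays_def
proof
  fix n
  have iterate_bounds: "(Tbar \<beta> ^^ n) x \<in> {0<..1}"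
    using assms(1) by (rule funpow_Tbar_bounds)
  have between: "digit_sum \<beta> t m \<le> digit_sum \<beta> ((Tbar \<beta> ^^ n) x) m"
    "digit_sum \<beta> ((Tbar \<beta> ^^ n) x) m \<le> digit_sum \<beta> (t + 1 / \<beta>) m" for m
    using assms(2)[of m n] digit_sum_right_end[of m] by (cases "m = 0"; simp)+
  show "(Tbar \<beta> ^^ n) x \<in> {t..t + 1 / \<beta>}"
    using le_of_digit_sum_le[OF beta_gt_1 ends_bounds(1) iterate_bounds between(1)]
      le_of_digit_sum_le[OF beta_gt_1 iterate_bounds ends_bounds(2) between(2)] by simp
qed

abbreviation has_mechanical_point :: "real \<Rightarrow> bool" where
  "has_mechanical_point \<alpha> \<equiv> \<exists>y. mechanical_point \<beta> t {t..t + 1 / \<beta>} y \<alpha>"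

lemma has_mechanical_pointI:
  assumes "stays y" "dbar \<beta> y = upper_mechanical \<alpha>"
  shows "has_mechanical_point \<alpha>"
proof
  show "mechanical_point \<beta> t {t..t + 1 / \<beta>} y \<alpha>"
    using assms by unfold_locales
qed

lemma mechanical_point_of_fixed_point:
  assumes "(\<beta> - 1) * t \<le> of_int d" "of_int d \<le> (\<beta> - 1) * (t + 1 / \<beta>)"
  shows "has_mechanical_point (of_int d)"
proof -
  define p where "p = of_int d / (\<beta> - 1)"
  have fixed: "(\<beta> - 1) * p = of_int d"
    using beta_gt_1 by (simp add: p_def)
  have p_in_window: "p \<in> {t..t + 1 / \<beta>}"
    using assms beta_gt_1 by (simp flip: fixed)
  have "Tbar \<beta> p = p" and dbar: "dbar \<beta> p = upper_mechanical (of_int d)"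
    using dbar_fixed_point[OF J_bounds[OF p_in_window] fixed]
    by (simp_all add: upper_mechanical_of_int)
  then have "stays p"
    using p_in_window by (intro stays_of_forward_invariant[of "{p}"]) auto
  then show ?thesis
    using dbar by (rule has_mechanical_pointI)
qed

lemma mechanical_point_of_low_tail:
  assumes "dbar \<beta> t = case_nat a s" "lex_le s (\<lambda>_. a)"
  shows "has_mechanical_point (of_int a)"
proof (rule mechanical_point_of_fixed_point)
  have "lex_le (dbar \<beta> t) (\<lambda>_. a)"
    using lex_le_case_nat[OF assms(2), of a] by (simp add: assms(1) case_nat_const)
  then show "(\<beta> - 1) * t \<le> of_int a"
    using beta_gt_1 ends_bounds(1) by (intro fixed_point_ge_of_lex_le_const)
  have "of_int a < \<beta> * t"
    using dbar_0_bounds(1)[of \<beta> t] by (simp add: assms(1))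
  also have "\<dots> \<le> \<beta> * t + (1 - (t + 1 / \<beta>))"
    using right_end_le_1 by simp
  also have "\<dots> = (\<beta> - 1) * (t + 1 / \<beta>)"
    using beta_gt_1 by (simp add: field_simps)
  finally show "of_int a \<le> (\<beta> - 1) * (t + 1 / \<beta>)"
    by simp
qed

lemma mechanical_point_of_high_tail:
  assumes "dbar \<beta> t = case_nat a s" "lex_le (\<lambda>_. a + 1) s"
  shows "has_mechanical_point (of_int (a + 1))"
proof (rule mechanical_point_of_fixed_point)
  have "(\<beta> - 1) * t \<le> \<beta> * t"
    using t_pos by (simp add: left_diff_distrib)
  also have "\<dots> \<le> of_int (a + 1)"
    using dbar_0_bounds(2)[of \<beta> t] by (simp add: assms(1))
  finally show "(\<beta> - 1) * t \<le> of_int (a + 1)" .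
  have "lex_le (\<lambda>_. a + 1) (dbar \<beta> (t + 1 / \<beta>))"
    using lex_le_case_nat[OF assms(2), of "a + 1"]
    by (simp add: dbar_right_end[OF assms(1)] case_nat_const)
  then show "of_int (a + 1) \<le> (\<beta> - 1) * (t + 1 / \<beta>)"
    using beta_gt_1 ends_bounds(2) by (intro fixed_point_le_of_const_lex_le)
qed

lemma mechanical_point_of_upper_right_end:
  assumes "dbar \<beta> (t + 1 / \<beta>) = upper_mechanical \<alpha>"
  shows "has_mechanical_point \<alpha>"
proof -
  let ?u = "t + 1 / \<beta>"
  have digit_sum_u: "digit_sum \<beta> ?u m = \<lceil>\<alpha> * real m\<rceil>" for m
    using assms by (simp add: dbar_eq_upper_mechanical_iff)
  have "stays ?u"
  proof (rule stays_of_digit_sum_between)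
    fix n m :: nat assume "0 < m"
    then have "digit_sum \<beta> t m = \<lceil>\<alpha> * real m\<rceil> - 1"
      using digit_sum_right_end[of m] digit_sum_u by simp
    moreover have "digit_sum \<beta> ((Tbar \<beta> ^^ n) ?u) m = \<lceil>\<alpha> * real n + \<alpha> * real m\<rceil> - \<lceil>\<alpha> * real n\<rceil>"
      using digit_sum_add[of \<beta> ?u n m] by (simp add: digit_sum_u distrib_left)
    ultimately show "digit_sum \<beta> ((Tbar \<beta> ^^ n) ?u) m \<in> {digit_sum \<beta> t m..digit_sum \<beta> t m + 1}"
      unfolding atLeastAtMost_iff by linarith
  qed (rule ends_bounds)
  then show ?thesis
    using assms by (rule has_mechanical_pointI)
qed

lemma mechanical_point_of_lower_rational:
  assumes "dbar \<beta> t = lower_mechanical \<alpha>" "\<alpha> \<in> \<rat>"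
  shows "has_mechanical_point \<alpha>"
proof -
  have orbit: "digit_sum \<beta> ((Tbar \<beta> ^^ n) t) m = \<lfloor>\<alpha> * real (n + m)\<rfloor> - \<lfloor>\<alpha> * real n\<rfloor>" for n m
    using digit_sum_add[of \<beta> t n m] by (simp add: digit_sum_def assms(1) sum_lower_mechanical)
  have "stays t"
  proof (rule stays_of_digit_sum_between)
    fix n m :: nat
    show "digit_sum \<beta> ((Tbar \<beta> ^^ n) t) m \<in> {digit_sum \<beta> t m..digit_sum \<beta> t m + 1}"
      using orbit[of 0 m] unfolding orbit[of n m] atLeastAtMost_iff of_nat_add distrib_left
      by simp linarith
  qed (rule ends_bounds)
  obtain k where "\<And>n. \<lfloor>\<alpha> * real (k + n)\<rfloor> - \<lfloor>\<alpha> * real k\<rfloor> = \<lceil>\<alpha> * real n\<rceil>"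
    using rational_ceiling_eq_floor_shift[OF assms(2)] by blast
  then have "dbar \<beta> ((Tbar \<beta> ^^ k) t) = upper_mechanical \<alpha>"
    unfolding dbar_eq_upper_mechanical_iff orbit by blast
  then show ?thesis
    by (rule has_mechanical_pointI[OF stays_funpow[OF \<open>stays t\<close>]])
qed

lemma mechanical_point_of_lower_irrational:
  assumes "dbar \<beta> t = lower_mechanical \<alpha>" "\<alpha> \<notin> \<rat>"
  shows "has_mechanical_point \<alpha>"
proof (rule mechanical_point_of_upper_right_end)
  have "digit_sum \<beta> (t + 1 / \<beta>) m = \<lceil>\<alpha> * real m\<rceil>" for m
  proof (cases "m = 0")
    case False
    then have "digit_sum \<beta> (t + 1 / \<beta>) m = \<lfloor>\<alpha> * real m\<rfloor> + 1"
      by (simp add: digit_sum_right_end) (simp add: digit_sum_def assms(1) sum_lower_mechanical)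
    then show ?thesis
      using ceiling_eq_floor_add_1_of_irrational[OF assms(2)] False by simp
  qed simp
  then show "dbar \<beta> (t + 1 / \<beta>) = upper_mechanical \<alpha>"
    by (simp add: dbar_eq_upper_mechanical_iff)
qed

end

theorem theorem4p7:
  fixes \<beta> t :: real and a b :: int and s :: "nat \<Rightarrow> int" and J :: "real set"
  assumes "\<beta> > 1"
    and "0 \<le> t" and "t \<le> 1 - 1 / \<beta>"
    and "a \<in> alphabet \<beta>" and "\<forall>n. s n \<in> alphabet \<beta>"
    and "dbar \<beta> t = case_nat a s"
    and "b = a + 1"
    and "J = {t..t + 1 / \<beta>}"
  shows
    "(lex_le s (\<lambda>_. a) \<longrightarrow>
       (let S = orbit_closure \<beta> (word_value \<beta> (\<lambda>_. a)) in
          S \<subseteq> J \<and> Tbar_invariant \<beta> S \<and>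
          unique_invariant_orbit_closure_in \<beta> J S \<and>
          set_has_frequency \<beta> S (real_of_int a))) \<and>
     (lex_le (\<lambda>_. b) s \<longrightarrow>
       (let S = orbit_closure \<beta> (word_value \<beta> (\<lambda>_. b)) in
          S \<subseteq> J \<and> Tbar_invariant \<beta> S \<and>
          unique_invariant_orbit_closure_in \<beta> J S \<and>
          set_has_frequency \<beta> S (real_of_int b))) \<and>
     (\<forall>\<alpha>\<in>{real_of_int a..real_of_int b}.
        case_nat a s = lower_mechanical \<alpha> \<or> case_nat b s = upper_mechanical \<alpha> \<longrightarrow>
       (let S = orbit_closure \<beta> (word_value \<beta> (upper_mechanical \<alpha>)) in
          S \<subseteq> J \<and> Tbar_invariant \<beta> S \<and>
          unique_invariant_orbit_closure_in \<beta> J S \<and>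
          set_has_frequency \<beta> S \<alpha>))"
proof -
  \<comment> \<open>The digit formula assigns the first digit \<open>-1\<close> to \<open>t = 0\<close>.\<close>
  have "t \<noteq> 0"
    using fun_cong[OF assms(6), of 0] assms(4) by (auto simp: dbar_def alphabet_def)
  then interpret interval_window \<beta> t
    using assms(1-3) by unfold_locales auto
  have orbit_closure_claim: "let S = orbit_closure \<beta> (word_value \<beta> (upper_mechanical \<alpha>)) in
      S \<subseteq> J \<and> Tbar_invariant \<beta> S \<and>
      unique_invariant_orbit_closure_in \<beta> J S \<and> set_has_frequency \<beta> S \<alpha>"
    if "has_mechanical_point \<alpha>" for \<alpha>
    using that mechanical_point.mechanical_orbit_closure unfolding assms(8) by blast
  have "has_mechanical_point (of_int a)" if "lex_le s (\<lambda>_. a)"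
    using mechanical_point_of_low_tail[OF assms(6) that] .
  moreover have "has_mechanical_point (of_int b)" if "lex_le (\<lambda>_. b) s"
    using mechanical_point_of_high_tail[OF assms(6)] that assms(7) by simp
  moreover have "has_mechanical_point \<alpha>"
    if "case_nat a s = lower_mechanical \<alpha> \<or> case_nat b s = upper_mechanical \<alpha>" for \<alpha>
    using that mechanical_point_of_lower_rational mechanical_point_of_lower_irrational
      mechanical_point_of_upper_right_end dbar_right_end[OF assms(6)] assms(6,7) by metis
  ultimately show ?thesis
    using orbit_closure_claim upper_mechanical_of_int by metis
qed

end
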